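(* There is a constant $c>0$ such that for every $n\ge 1$, every string $T$ of length $n$ and every position $i$ with $1\le i\le n$, we have $|\mathsf{MUS}(T,i)|\le c\sqrt{n}$. Moreover, this bound is tight: there exist a constant $c'>0$, an infinite family of strings $T$ of unbounded length, and for each such $T$ a position $p$ in $T$, such that $|\mathsf{MUS}(T,p)|\ge c'\sqrt{|T|}$.
   Context: Strings are finite sequences over an alphabet $\Sigma$. For a string $T$ of length $n$, $T[i]$ is its $i$-th character and $T[i..j]$ is the substring from position $i$ to position $j$ (empty if $i>j$). An interval $[i..j]$ is an occurrence of a string $w$ in $T$ if $T[i..j]=w$; $\mathsf{occ}_T(w)$ is the number of occurrences of $w$ in $T$, with the convention $\mathsf{occ}_T(\varepsilon)=|T|+1$ for the empty string $\varepsilon$. A substring $w$ of $T$ is unique if $\mathsf{occ}_T(w)=1$ and a repeat if $\mathsf{occ}_T(w)\ge 2$. A unique substring $w$ of $T$ is a minimal unique substring (MUS) of $T$ if $\mathsf{occ}_T(w[1..|w|-1])\ge 2$ and $\mathsf{occ}_T(w[2..|w|])\ge 2$. Since each MUS occurs exactly once, it is identified with its occurrence $[k..j]$. $\mathsf{MUS}(T,i)$ denotes the set of MUSs $T[k..j]$ of $T$ with $k\le i\le j$, i.e. those containing position $i$. *)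

theory Defs
  imports Complex_Main
begin

text \<open>
  Strings are lists. Positions are 1-based, so \<open>substr T i j\<close> is the string \<open>T[i..j]\<close>;
  it is meant for \<open>1 \<le> i\<close> and \<open>j \<le> length T\<close>, and is empty for \<open>i > j\<close>.
\<close>

definition substr :: "'a list \<Rightarrow> nat \<Rightarrow> nat \<Rightarrow> 'a list" where
  "substr T i j = take (Suc j - i) (drop (i - 1) T)"

text \<open>Only nonempty intervals count as occurrences; \<open>occ\<close> treats the empty string separately.\<close>

definition is_occurrence :: "'a list \<Rightarrow> 'a list \<Rightarrow> nat \<times> nat \<Rightarrow> bool" where
  "is_occurrence T w = (\<lambda>(i, j). 1 \<le> i \<and> i \<le> j \<and> j \<le> length T \<and> substr T i j = w)"

definition occ :: "'a list \<Rightarrow> 'a list \<Rightarrow> nat" where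
  "occ T w = (if w = [] then length T + 1 else card {I. is_occurrence T w I})"

definition is_unique :: "'a list \<Rightarrow> 'a list \<Rightarrow> bool" where
  "is_unique T w \<longleftrightarrow> occ T w = 1"

definition is_repeat :: "'a list \<Rightarrow> 'a list \<Rightarrow> bool" where
  "is_repeat T w \<longleftrightarrow> occ T w \<ge> 2"

definition is_MUS :: "'a list \<Rightarrow> 'a list \<Rightarrow> bool" where
  "is_MUS T w \<longleftrightarrow>
     is_unique T w \<and>
     is_repeat T (substr w 1 (length w - 1)) \<and>
     is_repeat T (substr w 2 (length w))"

text \<open>A MUS is represented by the interval of its single occurrence.\<close>

definition MUS :: "'a list \<Rightarrow> nat \<Rightarrow> (nat \<times> nat) set" where
  "MUS T i = {(k, j). 1 \<le> k \<and> k \<le> i \<and> i \<le> j \<and> j \<le> length T \<and> is_MUS T (substr T k j)}"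

end

theory Submission
  imports Defs
begin

text \<open>
  Upper bound: put \<open>L = \<lfloor>sqrt n\<rfloor>\<close>. MUSs are not nested, so all but \<open>2 L + 1\<close> of those through \<open>i\<close>
  contain the core \<open>[i - L..i + L]\<close> even after dropping their first letter. What remains then
  reoccurs shifted by some \<open>d \<noteq> 0\<close>, and distinct MUSs have distinct shifts. If no two
  shifts are closer than \<open>L\<close>, there are at most \<open>n / L + 1\<close> of them. Otherwise the core has a period
  \<open>p < L\<close>; let \<open>[a..b]\<close> be the maximal run of period \<open>p\<close> around it. Two MUSs that both stick out of
  the run on the left (or both on the right) cannot have shifts closer than \<open>L\<close>, because the
  break of the period has to be matched; and the unique substrings inside the run number at most \<open>p\<close>.

  Lower bound: in \<open>a\<^sup>mb\<^sup>mc \<cdot> \<Prod>\<^sub>s (a\<^sup>m\<^sup>-\<^sup>sb\<^sup>sc)\<close>, of length \<open>O(m\<^sup>2)\<close>, every \<open>a\<^sup>m\<^sup>-\<^sup>sb\<^sup>s\<^sup>+\<^sup>1\<close> with \<open>s < m\<close> occurs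
  only in the leading block, where it crosses position \<open>m\<close>, and both its one-letter truncations are
  among the later blocks.
\<close>

section \<open>Upper bound\<close>

text \<open>\<open>f y\<close> is the character at position \<open>y\<close>. Positions are integers because shifts can be negative.\<close>

locale minimal_unique_family =
  fixes f :: "int \<Rightarrow> 'a" and n i :: int and M :: "(int \<times> int) set"
  assumes bounds: "(k, j) \<in> M \<Longrightarrow> 1 \<le> k \<and> k \<le> i \<and> i \<le> j \<and> j \<le> n"
    and unique: "\<lbrakk>(k, j) \<in> M; 1 \<le> k + d; j + d \<le> n; \<forall>y\<in>{k..j}. f (y + d) = f y\<rbrakk> \<Longrightarrow> d = 0"
    and repeat_tail: "\<lbrakk>(k, j) \<in> M; k < j\<rbrakk> \<Longrightarrow>
      \<exists>d. d \<noteq> 0 \<and> 1 \<le> k + 1 + d \<and> j + d \<le> n \<and> (\<forall>y\<in>{k+1..j}. f (y + d) = f y)"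
    and repeat_butlast: "\<lbrakk>(k, j) \<in> M; k < j\<rbrakk> \<Longrightarrow>
      \<exists>d. d \<noteq> 0 \<and> 1 \<le> k + d \<and> j - 1 + d \<le> n \<and> (\<forall>y\<in>{k..j-1}. f (y + d) = f y)"
begin

text \<open>If the containment were strict, the longer interval would still contain the shorter one
  after losing its first or its last letter. The second occurrence of this truncation then carries a
  second occurrence of the shorter interval.\<close>

lemma no_nesting:
  assumes "(k, j) \<in> M" "(k', j') \<in> M" "k \<le> k'" "j' \<le> j"
  shows "k = k' \<and> j = j'"
proof (rule ccontr)
  assume neq: "\<not> (k = k' \<and> j = j')"
  have lt: "k < j" using bounds[OF assms(1)] bounds[OF assms(2)] assms(3,4) neq by linarith
  show False
  proof (cases "k < k'")
    case True
    obtain d where d: "d \<noteq> 0" "1 \<le> k + 1 + d" "j + d \<le> n" "\<forall>y\<in>{k+1..j}. f (y + d) = f y"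
      using repeat_tail[OF assms(1) lt] by blast
    have "\<forall>y\<in>{k'..j'}. f (y + d) = f y" using d(4) True assms(4) by auto
    then show False using unique[OF assms(2), of d] d True assms(4) by auto
  next
    case False
    then have "j' < j" using neq assms(3,4) by auto
    obtain d where d: "d \<noteq> 0" "1 \<le> k + d" "j - 1 + d \<le> n" "\<forall>y\<in>{k..j-1}. f (y + d) = f y"
      using repeat_butlast[OF assms(1) lt] by blast
    have "\<forall>y\<in>{k'..j'}. f (y + d) = f y" using d(4) \<open>j' < j\<close> assms(3) by auto
    then show False using unique[OF assms(2), of d] d \<open>j' < j\<close> assms(3) by auto
  qed
qed

text \<open>Two intervals with a common end are nested, hence equal.\<close>

lemma inj_on_fst: "inj_on fst M"
  by (rule inj_onI) (metis no_nesting linear order_refl prod.collapse)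

lemma inj_on_snd: "inj_on snd M"
  by (rule inj_onI) (metis no_nesting linear order_refl prod.collapse)

text \<open>The strict \<open>k < i - L\<close> lets the truncation \<open>[k+1..j]\<close> still
  cover the whole window \<open>[i-L..i+L]\<close>.\<close>

definition core :: "int \<Rightarrow> (int \<times> int) set" where
  "core L = {(k, j). (k, j) \<in> M \<and> k < i - L \<and> i + L \<le> j}"

lemma core_shift_exists:
  assumes "0 < L"
  shows "\<exists>d. \<forall>(k, j)\<in>core L. d (k, j) \<noteq> 0 \<and> 1 \<le> k + 1 + d (k, j) \<and> j + d (k, j) \<le> n
              \<and> (\<forall>y\<in>{k+1..j}. f (y + d (k, j)) = f y)"
proof -
  have "\<exists>d. d \<noteq> 0 \<and> 1 \<le> fst t + 1 + d \<and> snd t + d \<le> n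
              \<and> (\<forall>y\<in>{fst t+1..snd t}. f (y + d) = f y)" if t: "t \<in> core L" for t
    using repeat_tail[of "fst t" "snd t"] t assms by (auto simp: core_def)
  then obtain d where "\<forall>t\<in>core L. d t \<noteq> 0 \<and> 1 \<le> fst t + 1 + d t \<and> snd t + d t \<le> n
              \<and> (\<forall>y\<in>{fst t+1..snd t}. f (y + d t) = f y)"
    by metis
  then show ?thesis by (intro exI[of _ d]) auto
qed

text \<open>The bound is that of the periodic case: \<open>n div L + 1\<close> for the intervals
  sticking out of the run on either side, and \<open>L\<close> for those whose truncation stays
  inside. If the shifts are separated, a single \<open>n div L + 1\<close> suffices.\<close>

lemma card_core:
  assumes L: "0 < L" and n: "0 \<le> n"
  shows "int (card (core L)) \<le> 2 * (n div L) + L + 2"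
proof -
  obtain d where d: "\<And>k j. (k, j) \<in> core L \<Longrightarrow> d (k, j) \<noteq> 0 \<and> 1 \<le> k + 1 + d (k, j) \<and> j + d (k, j) \<le> n"
    and match: "\<And>k j y. (k, j) \<in> core L \<Longrightarrow> k < y \<Longrightarrow> y \<le> j \<Longrightarrow> f (y + d (k, j)) = f y"
    using core_shift_exists[OF L] by fastforce
  have C: "(k, j) \<in> M \<and> k < i - L \<and> i + L \<le> j" if "(k, j) \<in> core L" for k j
    using that by (simp add: core_def)
  \<comment> \<open>Both shifted intervals contain \<open>i\<close>, so a common shift would also match their union,
      which contains the second unique interval.\<close>
  have inj_d_aux: False if s: "(k, j) \<in> core L" and t: "(k', j') \<in> core L" and "k < k'"
    and eq: "d (k, j) = d (k', j')" for k j k' j'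
  proof -
    have "f (y + d (k, j)) = f y" if y: "y \<in> {k'..j'}" for y
    proof (cases "y \<le> j")
      case True
      then show ?thesis using match[OF s, of y] y \<open>k < k'\<close> by auto
    next
      case False
      then show ?thesis using match[OF t, of y] y eq C[OF s] C[OF t] L by auto
    qed
    then show False
      using unique[of k' j' "d (k, j)"] C[OF t] d[OF s] d[OF t] \<open>k < k'\<close> eq by auto
  qed
  have inj_d: "s = t" if "s \<in> core L" "t \<in> core L" "d s = d t" for s t
  proof -
    have "fst s = fst t"
      using inj_d_aux[of "fst s" "snd s" "fst t" "snd t"] inj_d_aux[of "fst t" "snd t" "fst s" "snd s"] that
      by (metis linorder_neqE prod.collapse)
    then show ?thesis using inj_on_fst that C by (metis inj_onD prod.collapse)
  qed
  \<comment> \<open>The image \<open>i + d t\<close> of position \<open>i\<close> stays inside the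
    string; cutting the range \<open>0..n\<close> into buckets of length \<open>L\<close> separates
    shifts that are at least \<open>L\<close> apart.\<close>
  define B where "B t = (i + d t) div L" for t
  have B_range: "B ` core L \<subseteq> {0..n div L}"
  proof clarify
    fix k j assume t: "(k, j) \<in> core L"
    have "0 \<le> i + d (k, j)" "i + d (k, j) \<le> n" using d[OF t] C[OF t] L by auto
    then show "B (k, j) \<in> {0..n div L}" using L by (auto simp: B_def zdiv_mono1 pos_imp_zdiv_nonneg_iff)
  qed
  have n0: "0 \<le> n div L" using L n by (simp add: pos_imp_zdiv_nonneg_iff)
  have B_close: "\<bar>d s - d t\<bar> < L" if "B s = B t" for s t
  proof -
    have "L * B s \<le> i + d s \<and> i + d s < L * B s + L" for s
      using mult_div_mod_eq[of L "i + d s"] pos_mod_bound[OF L, of "i + d s"] pos_mod_sign[OF L, of "i + d s"]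
      unfolding B_def by linarith
    from this[of s] this[of t] that show ?thesis by auto
  qed
  have bucket_card: "int (card X) \<le> n div L + 1"
    if X: "X \<subseteq> core L"
      and sep: "\<And>s t. s \<in> X \<Longrightarrow> t \<in> X \<Longrightarrow> d s < d t \<Longrightarrow> d t - d s < L \<Longrightarrow> False" for X
  proof -
    have "inj_on B X"
    proof (rule inj_onI)
      fix s t assume st: "s \<in> X" "t \<in> X" "B s = B t"
      have "\<bar>d s - d t\<bar> < L" using B_close st(3) .
      then have "\<not> d s < d t" "\<not> d t < d s" using sep[of s t] sep[of t s] st by auto
      then have "d s = d t" by simp
      then show "s = t" using inj_d st X by blast
    qed
    then have "card X \<le> card {0..n div L}" using B_range X by (intro card_inj_on_le) auto
    then show ?thesis using n0 by simp
  qed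
  show ?thesis
  proof (cases "\<exists>s t. s \<in> core L \<and> t \<in> core L \<and> d s < d t \<and> d t - d s < L")
    case False
    then have "int (card (core L)) \<le> n div L + 1" by (intro bucket_card) auto
    then show ?thesis using L n0 by linarith
  next
    case True
    then obtain ks js kt jt where s: "(ks, js) \<in> core L" and t: "(kt, jt) \<in> core L"
      and st: "d (ks, js) < d (kt, jt)" "d (kt, jt) - d (ks, js) < L" by auto
    define p where "p = d (kt, jt) - d (ks, js)"
    have p: "0 < p" "p < L" using st by (auto simp: p_def)
    \<comment> \<open>Shifting \<open>y\<close> by the larger shift and \<open>y + p\<close> by the
      smaller one leads to the same position.\<close>
    have period: "f y = f (y + p)" if "i - L \<le> y" "y \<le> i + L - p" for y
    proof -
      have "f (y + d (kt, jt)) = f y" using match[OF t, of y] C[OF t] that p by auto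
      moreover have "f (y + p + d (ks, js)) = f (y + p)"
        using match[OF s, of "y + p"] C[OF s] that p by auto
      ultimately show ?thesis by (simp add: p_def)
    qed
    have core_in: "1 \<le> i - L" "i + L \<le> n" using bounds[of ks js] C[OF s] by auto
    \<comment> \<open>The run is extended to the left and to the right independently, each time
      starting from the window. \<open>A\<close> holds the possible left ends, \<open>E\<close>
      below the possible right ends.\<close>
    define A where "A = {a. 1 \<le> a \<and> a \<le> i - L \<and> (\<forall>y. a \<le> y \<and> y \<le> i + L - p \<longrightarrow> f y = f (y + p))}"
    have "A \<subseteq> {1..i-L}" by (auto simp: A_def)
    then have A: "finite A" "A \<noteq> {}" using finite_subset period core_in by (auto simp: A_def)
    define a where "a = Min A"
    have aA: "a \<in> A" using A by (simp add: a_def)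
    have a_le: "a \<le> x" if "x \<in> A" for x using A that by (simp add: a_def)
    have a_min: "f (a - 1) \<noteq> f (a - 1 + p)" if "1 < a"
    proof
      assume eq: "f (a - 1) = f (a - 1 + p)"
      have "f y = f (y + p)" if "a - 1 \<le> y" "y \<le> i + L - p" for y
        using eq aA that by (cases "y = a - 1") (auto simp: A_def)
      then have "a - 1 \<in> A" using aA \<open>1 < a\<close> by (auto simp: A_def)
      then show False using a_le by fastforce
    qed
    have a_per: "f y = f (y + p)" if "a \<le> y" "y \<le> i + L - p" for y using aA that by (auto simp: A_def)
    have a_bd: "1 \<le> a" "a \<le> i - L" using aA by (auto simp: A_def)
    define E where "E = {b. i + L \<le> b \<and> b \<le> n \<and> (\<forall>y. i - L \<le> y \<and> y \<le> b - p \<longrightarrow> f y = f (y + p))}"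
    have "E \<subseteq> {i+L..n}" by (auto simp: E_def)
    then have E: "finite E" "E \<noteq> {}" using finite_subset period core_in by (auto simp: E_def)
    define b where "b = Max E"
    have bE: "b \<in> E" using E by (simp add: b_def)
    have b_ge: "x \<le> b" if "x \<in> E" for x using E that by (simp add: b_def)
    have b_max: "f (b + 1 - p) \<noteq> f (b + 1)" if "b < n"
    proof
      assume eq: "f (b + 1 - p) = f (b + 1)"
      have "f y = f (y + p)" if "i - L \<le> y" "y \<le> b + 1 - p" for y
        using eq bE that by (cases "y = b + 1 - p") (auto simp: E_def)
      then have "b + 1 \<in> E" using bE \<open>b < n\<close> by (auto simp: E_def)
      then show False using b_ge by fastforce
    qed
    have b_per: "f y = f (y + p)" if "i - L \<le> y" "y \<le> b - p" for y using bE that by (auto simp: E_def)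
    have b_bd: "i + L \<le> b" "b \<le> n" using bE by (auto simp: E_def)
    \<comment> \<open>The two extensions overlap, since \<open>p < L\<close> gives
      \<open>i - L \<le> i + L - p\<close>.\<close>
    have run: "f y = f (y + p)" if "a \<le> y" "y \<le> b - p" for y
      using a_per[of y] b_per[of y] that p by linarith

    \<comment> \<open>Only \<open>[k+1..j]\<close> is known to reoccur, so the cases compare
      \<open>k + 1\<close>, not \<open>k\<close>, with \<open>a\<close>: the truncation contains
      \<open>a - 1\<close>, contains \<open>b + 1\<close>, or lies in \<open>[a..b]\<close>.\<close>
    define X where "X = {(k, j). (k, j) \<in> core L \<and> k + 1 < a}"
    define Y where "Y = {(k, j). (k, j) \<in> core L \<and> b < j}"
    define Z where "Z = {(k, j). (k, j) \<in> core L \<and> a - 1 \<le> k \<and> j \<le> b}"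
    \<comment> \<open>A copy of an interval reaching left of the run breaks the period at \<open>a - 1\<close>. In a copy
        shifted by slightly less, this break would fall inside the run.\<close>
    have X_card: "int (card X) \<le> n div L + 1"
    proof (rule bucket_card)
      show "X \<subseteq> core L" by (auto simp: X_def)
      fix s t assume "s \<in> X" "t \<in> X" and lt: "d s < d t" "d t - d s < L"
      then obtain k j k' j' where s: "s = (k, j)" "(k, j) \<in> core L" "k + 1 < a"
        and t: "t = (k', j')" "(k', j') \<in> core L" "k' + 1 < a" by (auto simp: X_def)
      define e where "e = d t - d s"
      note ms = match[OF s(2), folded s(1)] and mt = match[OF t(2), folded t(1)]
      note bds = C[OF s(2)] C[OF t(2)] s(3) t(3) a_bd p lt L
      have "f (a - 1) = f (a - 1 + d t)" using mt[of "a - 1"] bds by auto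
      also have "\<dots> = f (a - 1 + e + d s)" by (rule arg_cong[of _ _ f]) (simp add: e_def)
      also have "\<dots> = f (a - 1 + e)" using bds by (intro ms) (auto simp: e_def)
      \<comment> \<open>Since \<open>1 \<le> e\<close>, position \<open>a - 1 + e\<close> is already
        in the run; \<open>e, p < L\<close> keep \<open>a - 1 + e + p\<close> left of the end of the
        window.\<close>
      also have "\<dots> = f (a - 1 + e + p)" using bds by (intro a_per) (auto simp: e_def)
      also have "\<dots> = f (a - 1 + e + p + d s)" using bds by (intro ms[symmetric]) (auto simp: e_def)
      also have "\<dots> = f (a - 1 + p + d t)" by (rule arg_cong[of _ _ f]) (simp add: e_def)
      also have "\<dots> = f (a - 1 + p)" using bds by (intro mt) auto
      finally show False using a_min bounds[of k j] bds by auto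
    qed
    \<comment> \<open>The mirror image: the mismatch between \<open>b + 1 - p\<close> and
      \<open>b + 1\<close> is moved left by \<open>e\<close> into the run, with the roles of
      \<open>s\<close> and \<open>t\<close> exchanged.\<close>
    have Y_card: "int (card Y) \<le> n div L + 1"
    proof (rule bucket_card)
      show "Y \<subseteq> core L" by (auto simp: Y_def)
      fix s t assume "s \<in> Y" "t \<in> Y" and lt: "d s < d t" "d t - d s < L"
      then obtain k j k' j' where s: "s = (k, j)" "(k, j) \<in> core L" "b < j"
        and t: "t = (k', j')" "(k', j') \<in> core L" "b < j'" by (auto simp: Y_def)
      define e where "e = d t - d s"
      note ms = match[OF s(2), folded s(1)] and mt = match[OF t(2), folded t(1)]
      note bds = C[OF s(2)] C[OF t(2)] s(3) t(3) b_bd p lt L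
      have "f (b + 1 - p) = f (b + 1 - p + d s)" using ms[of "b + 1 - p"] bds by auto
      also have "\<dots> = f (b + 1 - p - e + d t)" by (rule arg_cong[of _ _ f]) (simp add: e_def)
      also have "\<dots> = f (b + 1 - p - e)" using bds by (intro mt) (auto simp: e_def)
      also have "\<dots> = f (b + 1 - p - e + p)" using bds by (intro b_per) (auto simp: e_def)
      also have "\<dots> = f (b + 1 - e)" by (rule arg_cong[of _ _ f]) simp
      also have "\<dots> = f (b + 1 - e + d t)" using bds by (intro mt[symmetric]) (auto simp: e_def)
      also have "\<dots> = f (b + 1 + d s)" by (rule arg_cong[of _ _ f]) (simp add: e_def)
      also have "\<dots> = f (b + 1)" using bds by (intro ms) auto
      finally show False using b_max bounds[of k j] bds by auto
    qed
    \<comment> \<open>Inside the run, shifting by \<open>-p\<close> would give a second occurrence unless \<open>k < a + p\<close>.\<close>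
    have Z_fst: "fst ` Z \<subseteq> {a - 1..a + p - 1}"
    proof (rule image_subsetI)
      fix t assume "t \<in> Z"
      then obtain k j where t: "t = (k, j)" and Z: "(k, j) \<in> core L" "a - 1 \<le> k" "j \<le> b" by (auto simp: Z_def)
      have "k < a + p"
      proof (rule ccontr)
        assume "\<not> k < a + p"
        then have "\<forall>y\<in>{k..j}. f (y + - p) = f y" using run[of "y - p" for y] Z by fastforce
        then have "- p = 0" using \<open>\<not> k < a + p\<close> C[OF Z(1)] Z b_bd p a_bd by (intro unique[of k j]) auto
        then show False using p by simp
      qed
      then show "fst t \<in> {a - 1..a + p - 1}" using Z t by simp
    qed
    have "inj_on fst Z" by (rule inj_on_subset[OF inj_on_fst]) (auto simp: Z_def core_def)
    then have "card Z \<le> card {a - 1..a + p - 1}" using Z_fst by (intro card_inj_on_le) auto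
    \<comment> \<open>The range has \<open>p + 1\<close> elements, and \<open>p < L\<close>.\<close>
    then have Z_card: "int (card Z) \<le> L" using p by simp
    have "core L = X \<union> Y \<union> Z" by (auto simp: X_def Y_def Z_def)
    then have "card (core L) \<le> card X + card Y + card Z"
      using card_Un_le[of "X \<union> Y" Z] card_Un_le[of X Y] by simp
    then have "int (card (core L)) \<le> int (card X) + int (card Y) + int (card Z)" by linarith
    then show ?thesis using X_card Y_card Z_card by linarith
  qed
qed

text \<open>An interval outside \<open>core L\<close> starts at one of the \<open>L + 1\<close>
  positions \<open>i-L..i\<close> or ends at one of the \<open>L\<close> positions
  \<open>i..i+L-1\<close>, and either end determines it.\<close>

lemma card_M:
  assumes L: "0 < L" and n: "0 \<le> n"
  shows "int (card M) \<le> 2 * (n div L) + 3 * L + 3"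
proof -
  define X where "X = {t \<in> M. i - L \<le> fst t}"
  define Y where "Y = {t \<in> M. snd t < i + L}"
  have "inj_on fst X" by (rule inj_on_subset[OF inj_on_fst]) (auto simp: X_def)
  moreover have "fst ` X \<subseteq> {i - L..i}" using bounds by (auto simp: X_def)
  ultimately have "card X \<le> card {i - L..i}" by (intro card_inj_on_le) auto
  then have X: "int (card X) \<le> L + 1" using L by simp
  have "inj_on snd Y" by (rule inj_on_subset[OF inj_on_snd]) (auto simp: Y_def)
  moreover have "snd ` Y \<subseteq> {i..<i + L}" using bounds by (auto simp: Y_def)
  ultimately have "card Y \<le> card {i..<i + L}" by (intro card_inj_on_le) auto
  then have Y: "int (card Y) \<le> L" using L by simp
  have "M = X \<union> Y \<union> core L" by (auto simp: X_def Y_def core_def)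
  then have "card M \<le> card X + card Y + card (core L)"
    using card_Un_le[of "X \<union> Y" "core L"] card_Un_le[of X Y] by simp
  then have "int (card M) \<le> int (card X) + int (card Y) + int (card (core L))" by linarith
  then show ?thesis using X Y card_core[OF L n] by linarith
qed

end

section \<open>From substrings to shifts of integer positions\<close>

lemma length_substr: "1 \<le> k \<Longrightarrow> j \<le> length T \<Longrightarrow> length (substr T k j) = Suc j - k"
  by (auto simp: substr_def)

lemma nth_substr: "1 \<le> k \<Longrightarrow> j \<le> length T \<Longrightarrow> x < Suc j - k \<Longrightarrow> substr T k j ! x = T ! (k - 1 + x)"
  by (auto simp: substr_def)

lemma substr_substr:
  assumes "1 \<le> k" "1 \<le> a" "b \<le> Suc j - k" 
  shows "substr (substr T k j) a b = substr T (k + a - 1) (k + b - 1)"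
  using assms by (auto simp: substr_def drop_take min_def add.commute)

abbreviation char_at :: "'a list \<Rightarrow> int \<Rightarrow> 'a" where
  "char_at T y \<equiv> T ! nat (y - 1)"

text \<open>Turns equality of substrings into the shift condition of the locale; the 0-based list
  index \<open>k - 1 + x\<close> is the 1-based position \<open>k + x\<close>.\<close>

lemma substr_eq_iff:
  assumes "1 \<le> k" "j \<le> length T" "1 \<le> int k + d" "int j + d \<le> int (length T)" "k \<le> j"
  shows "substr T (nat (int k + d)) (nat (int j + d)) = substr T k j \<longleftrightarrow>
         (\<forall>y\<in>{int k..int j}. char_at T (y + d) = char_at T y)" (is "?L \<longleftrightarrow> ?R")
proof -
  have len: "length (substr T (nat (int k + d)) (nat (int j + d))) = Suc j - k"
    using assms by (subst length_substr) auto
  have "?L \<longleftrightarrow> (\<forall>x<Suc j - k. T ! (nat (int k + d) - 1 + x) = T ! (k - 1 + x))"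
    using assms len by (auto simp: list_eq_iff_nth_eq length_substr nth_substr)
  also have "\<dots> \<longleftrightarrow> ?R"
  proof (intro iffI ballI allI impI)
    fix y assume *: "\<forall>x<Suc j - k. T ! (nat (int k + d) - 1 + x) = T ! (k - 1 + x)" and y: "y \<in> {int k..int j}"
    have "nat (int k + d) - 1 + nat (y - int k) = nat (y + d - 1)" "k - 1 + nat (y - int k) = nat (y - 1)"
      using y assms by auto
    moreover have "nat (y - int k) < Suc j - k" using y assms by auto
    ultimately show "char_at T (y + d) = char_at T y" using * by metis
  next
    fix x assume *: ?R and x: "x < Suc j - k"
    have "nat (int k + d) - 1 + x = nat (int k + int x + d - 1)" "k - 1 + x = nat (int k + int x - 1)"
      using assms by auto
    moreover have "int k + int x \<in> {int k..int j}" using x by auto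
    ultimately show "T ! (nat (int k + d) - 1 + x) = T ! (k - 1 + x)" using * by metis
  qed
  finally show ?thesis .
qed

lemma finite_occurrences: "finite {I. is_occurrence T w I}"
  by (rule finite_subset[of _ "{1..length T} \<times> {1..length T}"]) (auto simp: is_occurrence_def)

lemma is_unique_substrD:
  assumes "1 \<le> k" "k \<le> j" "j \<le> length T" "is_unique T (substr T k j)"
    and "1 \<le> int k + d" "int j + d \<le> int (length T)"
    and "\<forall>y\<in>{int k..int j}. char_at T (y + d) = char_at T y"
  shows "d = 0"
proof -
  have "substr T k j \<noteq> []" using length_substr[of k j T] assms by (metis Suc_diff_le list.size(3) nat.distinct(1))
  then have "card {I. is_occurrence T (substr T k j) I} = 1"
    using assms(4) by (simp add: is_unique_def occ_def)
  then obtain I where I: "{I. is_occurrence T (substr T k j) I} = {I}" by (auto simp: card_1_singleton_iff)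
  have "is_occurrence T (substr T k j) (k, j)" using assms by (auto simp: is_occurrence_def)
  moreover have "is_occurrence T (substr T k j) (nat (int k + d), nat (int j + d))"
    using assms substr_eq_iff[of k j T d] by (auto simp: is_occurrence_def)
  ultimately have "(k, j) = (nat (int k + d), nat (int j + d))" using I by (metis mem_Collect_eq singletonD)
  then show ?thesis using assms by auto
qed

text \<open>Some occurrence differs from \<open>[k..j]\<close>; as the lengths agree, the difference
  of the left ends is the shift. \<open>k \<le> j\<close> excludes the empty string and its
  conventional count.\<close>

lemma is_repeat_substrD:
  assumes "1 \<le> k" "k \<le> j" "j \<le> length T" "is_repeat T (substr T k j)"
  shows "\<exists>d. d \<noteq> 0 \<and> 1 \<le> int k + d \<and> int j + d \<le> int (length T) \<and>
           (\<forall>y\<in>{int k..int j}. char_at T (y + d) = char_at T y)"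
proof -
  have len: "length (substr T k j) = Suc j - k" using length_substr[of k j T] assms by auto
  then have "card {I. is_occurrence T (substr T k j) I} \<ge> 2"
    using assms by (auto simp: is_repeat_def occ_def split: if_splits)
  then have "\<not> {I. is_occurrence T (substr T k j) I} \<subseteq> {(k, j)}"
    using card_mono[of "{(k, j)}" "{I. is_occurrence T (substr T k j) I}"] by auto
  then obtain a b where ab: "is_occurrence T (substr T k j) (a, b)" "(a, b) \<noteq> (k, j)" by auto
  then have o: "1 \<le> a" "a \<le> b" "b \<le> length T" "substr T a b = substr T k j"
    by (auto simp: is_occurrence_def)
  have "Suc b - a = Suc j - k" using o len length_substr[of a b T] by auto
  then have b: "int b - int a = int j - int k" using o assms by linarith
  define d where "d = int a - int k"
  have "nat (int k + d) = a" "nat (int j + d) = b" using b by (auto simp: d_def)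
  moreover have "d \<noteq> 0" using ab(2) b by (auto simp: d_def)
  ultimately show ?thesis using substr_eq_iff[of k j T d] o b assms by (intro exI[of _ d]) (auto simp: d_def)
qed

lemma finite_MUS: "finite (MUS T i)"
  by (rule finite_subset[of _ "{1..length T} \<times> {1..length T}"]) (auto simp: MUS_def)

text \<open>\<open>card_M\<close> transferred along the embedding of natural into integer positions:
  uniqueness and the two repeated truncations are exactly what the locale asks for.\<close>

lemma card_MUS_le:
  assumes L: "0 < L"
  shows "card (MUS T i) \<le> 2 * (length T div L) + 3 * L + 3"
proof -
  let ?M = "map_prod int int ` MUS T i"
  interpret minimal_unique_family "char_at T" "int (length T)" "int i" ?M
  proof
    fix k j assume "(k, j) \<in> ?M"
    then show "1 \<le> k \<and> k \<le> int i \<and> int i \<le> j \<and> j \<le> int (length T)" by (auto simp: MUS_def)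
  next
    fix k j d assume kj: "(k, j) \<in> ?M" and d: "1 \<le> k + d" "j + d \<le> int (length T)"
      "\<forall>y\<in>{k..j}. char_at T (y + d) = char_at T y"
    obtain k' j' where e: "(k', j') \<in> MUS T i" "k = int k'" "j = int j'" using kj by auto
    show "d = 0" using is_unique_substrD[of k' j' T d] e d by (auto simp: MUS_def is_MUS_def)
  next
    fix k j assume kj: "(k, j) \<in> ?M" "k < j"
    obtain k' j' where e: "(k', j') \<in> MUS T i" "k = int k'" "j = int j'" using kj by auto
    then have b: "1 \<le> k'" "k' < j'" "j' \<le> length T" "is_MUS T (substr T k' j')" using kj by (auto simp: MUS_def)
    have "is_repeat T (substr T (k' + 1) j')" "is_repeat T (substr T k' (j' - 1))"
      using b length_substr[of k' j' T] substr_substr[of k' 2 "Suc j' - k'" j' T]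
        substr_substr[of k' 1 "j' - k'" j' T] by (auto simp: is_MUS_def)
    then have r: "\<exists>d. d \<noteq> 0 \<and> 1 \<le> int (k' + 1) + d \<and> int j' + d \<le> int (length T) \<and>
           (\<forall>y\<in>{int (k' + 1)..int j'}. char_at T (y + d) = char_at T y)"
        "\<exists>d. d \<noteq> 0 \<and> 1 \<le> int k' + d \<and> int (j' - 1) + d \<le> int (length T) \<and>
           (\<forall>y\<in>{int k'..int (j' - 1)}. char_at T (y + d) = char_at T y)"
      using b is_repeat_substrD[of "k' + 1" j' T] is_repeat_substrD[of k' "j' - 1" T] by auto
    show "\<exists>d. d \<noteq> 0 \<and> 1 \<le> k + 1 + d \<and> j + d \<le> int (length T) \<and> (\<forall>y\<in>{k+1..j}. char_at T (y + d) = char_at T y)"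
      using r(1) e by (simp add: add.commute)
    show "\<exists>d. d \<noteq> 0 \<and> 1 \<le> k + d \<and> j - 1 + d \<le> int (length T) \<and> (\<forall>y\<in>{k..j-1}. char_at T (y + d) = char_at T y)"
      using r(2) e b by (simp add: of_nat_diff)
  qed
  have "card ?M = card (MUS T i)" by (intro card_image) (auto simp: inj_on_def)
  then have "int (card (MUS T i)) \<le> int (2 * (length T div L) + 3 * L + 3)"
    using card_M[of "int L"] L by (simp add: zdiv_int)
  then show ?thesis by linarith
qed

lemma card_MUS_le_sqrt:
  assumes "1 \<le> length T"
  shows "real (card (MUS T i)) \<le> 12 * sqrt (real (length T))"
proof -
  define n L where "n = length T" and "L = nat \<lfloor>sqrt (real n)\<rfloor>"
  have s1: "1 \<le> sqrt (real n)" using assms by (simp add: n_def)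
  have L: "real L \<le> sqrt (real n)" "sqrt (real n) < real L + 1" using s1 by (auto simp: L_def)
  have L1: "1 \<le> L" using s1 by (auto simp: L_def le_nat_iff le_floor_iff)
  have "real n = sqrt (real n) * sqrt (real n)" by simp
  also have "\<dots> < (real L + 1) * (real L + 1)" using L s1 by (intro mult_strict_mono) auto
  also have "\<dots> = real ((L + 1) * (L + 1))" by (simp add: algebra_simps)
  finally have "n < (L + 1) * (L + 1)" by (simp only: of_nat_less_iff)
  \<comment> \<open>\<open>(L + 1) * (L + 1)\<close> is \<open>L * L + 2 * L + 1\<close>, and
    \<open>1 \<le> L\<close>.\<close>
  then have "n < L * (L + 3)" using L1 by (simp add: algebra_simps)
  then have "n div L < L + 3" using L1 by (simp add: div_less_iff_less_mult mult.commute)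
  \<comment> \<open>The bound is at most \<open>2 * (L + 2) + 3 * L + 3 = 5 * L + 7\<close>.\<close>
  then have "card (MUS T i) \<le> 12 * L"
    using card_MUS_le[of L T i] L1 by (simp add: n_def)
  then have "real (card (MUS T i)) \<le> 12 * real L" by (metis of_nat_le_iff of_nat_mult of_nat_numeral)
  then show ?thesis using L by (simp add: n_def)
qed

section \<open>Lower bound\<close>

lemma is_occurrence_iff:
  assumes "w \<noteq> []"
  shows "is_occurrence T w (i, j) \<longleftrightarrow>
    (\<exists>p q. T = p @ w @ q \<and> i = Suc (length p) \<and> j = length p + length w)"
proof
  assume occ: "is_occurrence T w (i, j)"
  then have "T = take (i - 1) T @ w @ drop j T"
    using append_take_drop_id[of "i - 1" T] append_take_drop_id[of "Suc j - i" "drop (i - 1) T"]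
    by (auto simp: is_occurrence_def substr_def)
  moreover have "length w = Suc j - i" using occ by (auto simp: is_occurrence_def length_substr)
  ultimately show "\<exists>p q. T = p @ w @ q \<and> i = Suc (length p) \<and> j = length p + length w"
    using occ by (intro exI[of _ "take (i - 1) T"] exI[of _ "drop j T"]) (auto simp: is_occurrence_def)
next
  assume "\<exists>p q. T = p @ w @ q \<and> i = Suc (length p) \<and> j = length p + length w"
  then show "is_occurrence T w (i, j)"
    using assms by (cases w) (auto simp: is_occurrence_def substr_def)
qed

lemma is_uniqueI:
  assumes "w \<noteq> []" "T = p @ w @ q"
    and "\<And>p' q'. T = p' @ w @ q' \<Longrightarrow> length p' = length p"
  shows "is_unique T w"
proof -
  have "is_occurrence T w I \<longleftrightarrow> I = (Suc (length p), length p + length w)" for I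
  proof
    assume "is_occurrence T w I"
    then obtain p' q' where "T = p' @ w @ q'" "I = (Suc (length p'), length p' + length w)"
      using is_occurrence_iff[OF assms(1)] by (cases I) blast
    then show "I = (Suc (length p), length p + length w)" using assms(3) by metis
  next
    assume "I = (Suc (length p), length p + length w)"
    then show "is_occurrence T w I" using is_occurrence_iff[OF assms(1)] assms(2) by blast
  qed
  then have "{I. is_occurrence T w I} = {(Suc (length p), length p + length w)}" by simp
  then show ?thesis using assms(1) by (simp add: is_unique_def occ_def)
qed

lemma is_repeatI:
  assumes "T = p @ w @ q" "T = p' @ w @ q'" "length p < length p'"
  shows "is_repeat T w"
proof (cases "w = []")
  case True
  \<comment> \<open>\<open>length p < length p'\<close> makes \<open>T\<close> nonempty, so the
    conventional count is at least 2.\<close>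
  then show ?thesis using assms(2,3) by (auto simp: is_repeat_def occ_def)
next
  case False
  have "card {(Suc (length p), length p + length w), (Suc (length p'), length p' + length w)}
          \<le> card {I. is_occurrence T w I}"
  proof (intro card_mono finite_occurrences)
    have "is_occurrence T w (Suc (length p), length p + length w)"
      using is_occurrence_iff[OF False] assms(1) by blast
    moreover have "is_occurrence T w (Suc (length p'), length p' + length w)"
      using is_occurrence_iff[OF False] assms(2) by blast
    ultimately show "{(Suc (length p), length p + length w), (Suc (length p'), length p' + length w)}
        \<subseteq> {I. is_occurrence T w I}" by simp
  qed
  then show ?thesis using False assms(3) by (simp add: is_repeat_def occ_def)
qed

lemma is_MUS_iff_butlast_tl:
  "is_MUS T w \<longleftrightarrow> is_unique T w \<and> is_repeat T (butlast w) \<and> is_repeat T (tl w)"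
  by (simp add: is_MUS_def substr_def butlast_conv_take drop_Suc)

text \<open>A factor without \<open>c\<close> cannot cover the displayed \<open>c\<close>. On the
  left the prefix \<open>p\<close> is kept, so the position of \<open>w\<close> is not lost.\<close>

lemma split_at_absent_letter:
  assumes "p @ w @ q = xs @ c # ys" "c \<notin> set w"
  shows "(\<exists>q'. xs = p @ w @ q') \<or> (\<exists>p'. ys = p' @ w @ q)"
proof -
  consider us where "p = xs @ us" "us @ w @ q = c # ys" | us where "xs = p @ us" "w @ q = us @ c # ys"
    using assms(1) by (auto simp: append_eq_append_conv2)
  then show ?thesis
  proof cases
    case 1
    then show ?thesis using assms(2) by (cases us; cases w) auto
  next
    case 2
    then consider vs where "w = us @ vs" "vs @ q = c # ys" | vs where "us = w @ vs"
      by (auto simp: append_eq_append_conv2)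
    then show ?thesis
    proof cases
      case 1
      then show ?thesis using 2 assms(2) by (cases vs) auto
    next
      case 2
      then show ?thesis using \<open>xs = p @ us\<close> by simp
    qed
  qed
qed

text \<open>Separators are peeled off one by one: \<open>w\<close> lies in the first block or in the
  remaining ones.\<close>

lemma factor_of_separated_blocks:
  assumes "concat (map (\<lambda>s. g s @ [c]) xs) = p @ w @ q" "w \<noteq> []" "c \<notin> set w"
  shows "\<exists>s\<in>set xs. \<exists>p q. g s = p @ w @ q"
  using assms(1)
proof (induction xs arbitrary: p)
  case Nil
  then show ?case using assms(2) by simp
next
  case (Cons s xs)
  from Cons.prems have "p @ w @ q = g s @ c # concat (map (\<lambda>s. g s @ [c]) xs)" by simp
  from split_at_absent_letter[OF this assms(3)] show ?case using Cons.IH by auto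
qed

lemma count_list_replicate: "count_list (replicate k x) y = (if x = y then k else 0)"
  by (induction k) auto

section \<open>A word with many minimal unique substrings through one position\<close>

definition block :: "'a \<Rightarrow> 'a \<Rightarrow> nat \<Rightarrow> nat \<Rightarrow> 'a list" where
  "block a b m s = replicate (m - s) a @ replicate s b"

text \<open>The separated blocks run over all \<open>s\<close> from 0 to \<open>m\<close>, because
  the two truncations of the \<open>s\<close>-th candidate are blocks \<open>s\<close> and
  \<open>s + 1\<close> with \<open>s < m\<close>.\<close>

definition many_MUS_word :: "'a \<Rightarrow> 'a \<Rightarrow> 'a \<Rightarrow> nat \<Rightarrow> 'a list" where
  "many_MUS_word a b c m =
     replicate m a @ replicate m b @ c # concat (map (\<lambda>s. block a b m s @ [c]) [0..<Suc m])"

lemma set_many_MUS_word: "set (many_MUS_word a b c m) \<subseteq> {a, b, c}"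
  by (auto simp: many_MUS_word_def block_def)

lemma length_many_MUS_word: "length (many_MUS_word a b c m) = 2 * m + 1 + (m + 1) * (m + 1)"
proof -
  have "map (length \<circ> (\<lambda>s. block a b m s @ [c])) [0..<Suc m] = map (\<lambda>_. Suc m) [0..<Suc m]"
    by (intro map_cong) (auto simp: block_def)
  then have "length (concat (map (\<lambda>s. block a b m s @ [c]) [0..<Suc m])) = sum_list (map (\<lambda>_. Suc m) [0..<Suc m])"
    by (simp only: length_concat map_map)
  also have "\<dots> = (m + 1) * (m + 1)" by (simp only: sum_list_triv) simp
  finally show ?thesis by (simp add: many_MUS_word_def)
qed

text \<open>\<open>2 * m < length p\<close> places this copy behind the leading block and its
  separator, so it differs from any copy inside the leading block.\<close>

lemma block_occurs:
  assumes "s \<le> m"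
  shows "\<exists>p q. many_MUS_word a b c m = p @ block a b m s @ q \<and> 2 * m < length p"
proof -
  obtain us vs where "[0..<Suc m] = us @ s # vs" using assms split_list[of s "[0..<Suc m]"] by (auto simp del: upt_Suc)
  then have "many_MUS_word a b c m =
      (replicate m a @ replicate m b @ c # concat (map (\<lambda>s. block a b m s @ [c]) us)) @ block a b m s
        @ (c # concat (map (\<lambda>s. block a b m s @ [c]) vs))"
    unfolding many_MUS_word_def by simp
  then show ?thesis
    by (intro exI[of _ "replicate m a @ replicate m b @ c # concat (map (\<lambda>s. block a b m s @ [c]) us)"]
        exI[of _ "c # concat (map (\<lambda>s. block a b m s @ [c]) vs)"]) simp
qed

lemma mem_MUS_many_MUS_word:
  assumes dist: "a \<noteq> b" "a \<noteq> c" "b \<noteq> c" and s: "s < m"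
  shows "(s + 1, m + s + 1) \<in> MUS (many_MUS_word a b c m) m"
proof -
  define T where "T = many_MUS_word a b c m"
  define w where "w = replicate (m - s) a @ replicate (s + 1) b"
  define rest where "rest = concat (map (\<lambda>s. block a b m s @ [c]) [0..<Suc m])"
  have am: "replicate m a = replicate s a @ replicate (m - s) a"
    and bm: "replicate m b = replicate (s + 1) b @ replicate (m - s - 1) b"
    using s by (simp_all flip: replicate_add replicate_Suc)
  have T: "T = replicate m a @ replicate m b @ c # rest" by (simp add: T_def many_MUS_word_def rest_def)
  have Tw: "T = replicate s a @ w @ replicate (m - s - 1) b @ c # rest"
    unfolding T w_def am bm by simp
  have w: "w \<noteq> []" "c \<notin> set w" "length w = m + 1" using dist s by (auto simp: w_def)
  have "is_unique T w"
  proof (rule is_uniqueI[OF w(1) Tw])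
    fix p' q' assume "T = p' @ w @ q'"
    then have "p' @ w @ q' = (replicate m a @ replicate m b) @ c # rest" by (simp add: T)
    from split_at_absent_letter[OF this w(2)]
    show "length p' = length (replicate s a)"
    proof (elim disjE exE)
      fix q'' assume eq: "replicate m a @ replicate m b = p' @ w @ q''"
      \<comment> \<open>The 0-based index of the first \<open>b\<close> of \<open>w\<close>; the
        only change from \<open>a\<close> to \<open>b\<close> in the leading block is at index
        \<open>m\<close>.\<close>
      let ?l = "length p' + (m - s)"
      have len: "length p' + m + 1 \<le> 2 * m" using arg_cong[OF eq, of length] w by simp
      have "(replicate m a @ replicate m b) ! (?l - 1) = a" "(replicate m a @ replicate m b) ! ?l = b"
        unfolding eq using s by (auto simp: nth_append w_def)
      then have "?l - 1 < m" "m \<le> ?l" using dist len s by (auto simp: nth_append split: if_splits)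
      then show ?thesis using s by simp
    next
      fix p'' assume "rest = p'' @ w @ q'"
      from factor_of_separated_blocks[OF this[unfolded rest_def] w(1,2)]
      obtain s' p q where s': "s' \<le> m" and eq: "block a b m s' = p @ w @ q" by (auto simp del: upt_Suc simp: less_Suc_eq_le)
      \<comment> \<open>The letters of \<open>w\<close> would force both \<open>s' \<le> s\<close>
        and \<open>s + 1 \<le> s'\<close>.\<close>
      have "count_list (block a b m s') a \<ge> m - s" "count_list (block a b m s') b \<ge> s + 1"
        unfolding eq w_def using dist by (auto simp: count_list_replicate)
      then show ?thesis using dist s s' by (auto simp: block_def count_list_replicate)
    qed
  qed
  moreover have "is_repeat T (butlast w)"
  proof -
    have bw: "butlast w = block a b m s" 
      by (simp add: w_def block_def butlast_append flip: replicate_append_same)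
    obtain p q where occ: "T = p @ block a b m s @ q" "2 * m < length p"
      using block_occurs[of s m a b c] s T_def by auto
    have "T = replicate s a @ block a b m s @ b # replicate (m - s - 1) b @ c # rest"
      unfolding Tw w_def block_def by (simp add: replicate_app_Cons_same)
    then show ?thesis unfolding bw using occ s by (intro is_repeatI[OF _ occ(1)]) auto
  qed
  moreover have "is_repeat T (tl w)"
  proof -
    have aw: "w = a # block a b m (s + 1)" using s by (cases "m - s") (auto simp: w_def block_def)
    obtain p q where occ: "T = p @ block a b m (s + 1) @ q" "2 * m < length p"
      using block_occurs[of "s + 1" m a b c] s T_def by auto
    have center: "T = (replicate s a @ [a]) @ block a b m (s + 1) @ replicate (m - s - 1) b @ c # rest"
      using Tw unfolding aw by simp
    show ?thesis unfolding aw list.sel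
      by (rule is_repeatI[OF center occ(1)]) (use occ(2) s in simp)
  qed
  ultimately have "is_MUS T w" by (simp add: is_MUS_iff_butlast_tl)
  moreover have "is_occurrence T w (s + 1, m + s + 1)"
    unfolding is_occurrence_iff[OF w(1)] using Tw w(3)
    by (intro exI[of _ "replicate s a"] exI[of _ "replicate (m - s - 1) b @ c # rest"]) simp
  ultimately show ?thesis using s by (auto simp: MUS_def is_occurrence_def T_def)
qed

lemma card_MUS_many_MUS_word:
  assumes "a \<noteq> b" "a \<noteq> c" "b \<noteq> c"
  shows "m \<le> card (MUS (many_MUS_word a b c m) m)"
proof -
  have "card ((\<lambda>s. (s + 1, m + s + 1)) ` {..<m}) \<le> card (MUS (many_MUS_word a b c m) m)"
    using mem_MUS_many_MUS_word[OF assms] by (intro card_mono finite_MUS) auto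
  then show ?thesis by (simp add: card_image inj_on_def)
qed

lemma sqrt_length_many_MUS_word:
  assumes "1 \<le> m"
  shows "sqrt (real (length (many_MUS_word a b c m))) \<le> 3 * real m"
proof (rule real_le_lsqrt)
  \<comment> \<open>The left side is \<open>m * m + 4 * m + 2\<close>, at most
    \<open>7 * m * m\<close> for \<open>1 \<le> m\<close>.\<close>
  have "2 * m + 1 + (m + 1) * (m + 1) \<le> (3 * m)\<^sup>2"
    using mult_le_mono1[OF assms, of m] assms unfolding power2_eq_square by (simp add: algebra_simps del: One_nat_def; linarith)
  then have "real (2 * m + 1 + (m + 1) * (m + 1)) \<le> real ((3 * m)\<^sup>2)" by (rule of_nat_mono)
  then show "real (length (many_MUS_word a b c m)) \<le> (3 * real m)\<^sup>2"
    unfolding length_many_MUS_word by (simp only: of_nat_power of_nat_mult of_nat_numeral)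
qed simp

text \<open>The infinite type supplies three distinct letters. The position is the border
  \<open>m\<close> of the leading block, and \<open>1/3\<close> comes from
  \<open>sqrt (real (length T)) \<le> 3 * real m\<close>.\<close>

lemma many_MUS_family:
  assumes "infinite (UNIV :: 'a set)"
  shows "\<exists>Sigma :: 'a set. finite Sigma \<and>
              (\<exists>F \<subseteq> lists Sigma. infinite F \<and>
                (\<forall>N::nat. \<exists>T \<in> F. length T \<ge> N) \<and>
                (\<forall>T \<in> F. \<exists>p::nat. 1 \<le> p \<and> p \<le> length T \<and>
                  real (card (MUS T p)) \<ge> (1/3) * sqrt (real (length T))))"
proof -
  obtain A :: "'a set" where "finite A" "card A = 3" using infinite_arbitrarily_large[OF assms] by blast
  then obtain a b c :: 'a where dist: "a \<noteq> b" "a \<noteq> c" "b \<noteq> c" by (auto simp: card_3_iff)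
  let ?W = "many_MUS_word a b c"
  let ?F = "?W ` {1..}"
  \<comment> \<open>The length grows strictly with the parameter, so the words are distinct.\<close>
  have "inj_on ?W {1..}"
  proof (rule inj_onI)
    fix x y assume "?W x = ?W y"
    then have eq: "2 * x + 1 + (x + 1) * (x + 1) = 2 * y + 1 + (y + 1) * (y + 1)"
      by (metis length_many_MUS_word)
    have "\<not> x < y" if "2 * x + 1 + (x + 1) * (x + 1) = 2 * y + 1 + (y + 1) * (y + 1)" for x y :: nat
      using that mult_le_mono[of "x + 1" "y + 1" "x + 1" "y + 1"] by linarith
    from this[OF eq] this[OF eq[symmetric]] show "x = y" by simp
  qed
  then have "infinite ?F" by (simp add: finite_image_iff infinite_Ici)
  moreover have "?F \<subseteq> lists {a, b, c}" using set_many_MUS_word by fastforce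
  moreover have "\<exists>T\<in>?F. N \<le> length T" for N
    by (rule bexI[of _ "?W (Suc N)"]) (auto simp: length_many_MUS_word)
  moreover have "\<exists>p. 1 \<le> p \<and> p \<le> length T \<and> (1/3) * sqrt (real (length T)) \<le> real (card (MUS T p))"
    if "T \<in> ?F" for T
  proof -
    obtain m where m: "1 \<le> m" "T = ?W m" using \<open>T \<in> ?F\<close> by blast
    have "real m \<le> real (card (MUS T m))" using card_MUS_many_MUS_word[OF dist] m by simp
    then show ?thesis using sqrt_length_many_MUS_word[OF m(1), of a b c] m
      by (intro exI[of _ m]) (auto simp: length_many_MUS_word)
  qed
  ultimately show ?thesis by (intro exI[of _ "{a, b, c}"] conjI exI[of _ ?F]) auto
qed

theorem theorem1:
  assumes "infinite (UNIV :: 'a set)"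
  shows "(\<exists>c::real. c > 0 \<and>
            (\<forall>Sigma :: 'a set. \<forall>n::nat. n \<ge> 1 \<longrightarrow>
              (\<forall>T \<in> lists Sigma. length T = n \<longrightarrow>
                (\<forall>i::nat. 1 \<le> i \<and> i \<le> n \<longrightarrow>
                  real (card (MUS T i)) \<le> c * sqrt (real n)))))
       \<and> (\<exists>c'::real. c' > 0 \<and>
            (\<exists>Sigma :: 'a set. finite Sigma \<and>
              (\<exists>F \<subseteq> lists Sigma. infinite F \<and>
                (\<forall>N::nat. \<exists>T \<in> F. length T \<ge> N) \<and>
                (\<forall>T \<in> F. \<exists>p::nat. 1 \<le> p \<and> p \<le> length T \<and>
                  real (card (MUS T p)) \<ge> c' * sqrt (real (length T))))))"
proof (intro conjI)
  show "\<exists>c::real. c > 0 \<and>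
            (\<forall>Sigma :: 'a set. \<forall>n::nat. n \<ge> 1 \<longrightarrow>
              (\<forall>T \<in> lists Sigma. length T = n \<longrightarrow>
                (\<forall>i::nat. 1 \<le> i \<and> i \<le> n \<longrightarrow>
                  real (card (MUS T i)) \<le> c * sqrt (real n))))"
  proof (rule exI[of _ 12], intro conjI allI ballI impI)
    fix Sigma :: "'a set" and n i :: nat and T
    assume "n \<ge> 1" "length T = n"
    then show "real (card (MUS T i)) \<le> 12 * sqrt (real n)" using card_MUS_le_sqrt[of T i] by simp
  qed simp
  show "\<exists>c'::real. c' > 0 \<and>
            (\<exists>Sigma :: 'a set. finite Sigma \<and>
              (\<exists>F \<subseteq> lists Sigma. infinite F \<and>
                (\<forall>N::nat. \<exists>T \<in> F. length T \<ge> N) \<and>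
                (\<forall>T \<in> F. \<exists>p::nat. 1 \<le> p \<and> p \<le> length T \<and>
                  real (card (MUS T p)) \<ge> c' * sqrt (real (length T)))))"
    by (rule exI[of _ "1/3"], rule conjI, simp, rule many_MUS_family[OF assms])
qed

end
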